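(* For each $p>3$, the integrand $B_p^+\colon\mathbb{R}^{3\times 3}\to[0,+\infty)$ is not polyconvex (that is, there is a matrix in $\mathbb{R}^{3\times3}$ at which it is not polyconvex).
   Context: $|A|=\max_{|\xi|=1}|A\xi|$ is the operator norm. For $n=3$ and $p\geq n/2$, the Burkholder integrand is $$B_p(A)=\Big(\Big|1-\frac 3p\Big|\,|A|^3+\det A\Big)|A|^{p-3},\qquad B_p(0)=0,$$ and $B_p^+=\max\{0,B_p\}$. For $A\in\mathbb{R}^{3\times 3}$, $M(A)\in\mathbb{R}^{19}$ denotes the vector of all minors of $A$ (of orders $1,2,3$). A function $F\colon\mathbb{R}^{3\times3}\to\mathbb{R}$ is polyconvex at $A$ if there is a convex function $G\colon\mathbb{R}^{19}\to\mathbb{R}$ such that $F(A)=G(M(A))$ and $F\geq G\circ M$ on $\mathbb{R}^{3\times 3}$; $F$ is polyconvex if it is polyconvex at every $A\in\mathbb{R}^{3\times 3}$. *)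

theory Defs
  imports "HOL-Analysis.Analysis"
begin

definition opnorm :: "real ^ 'n ^ 'm \<Rightarrow> real" where
  "opnorm A = onorm (\<lambda>\<xi>. A *v \<xi>)"

lemma opnorm_le:
  fixes A :: "real ^ 'n ^ 'm"
  assumes "norm \<xi> = 1"
  shows "norm (A *v \<xi>) \<le> opnorm A"
  using onorm[OF matrix_vector_mul_bounded_linear, of A \<xi>] assms
  by (simp add: opnorm_def)

lemma opnorm_attained:
  fixes A :: "real ^ 'n ^ 'm"
  shows "\<exists>\<xi>. norm \<xi> = 1 \<and> norm (A *v \<xi>) = opnorm A"
proof -
  have "continuous_on (sphere 0 1) (\<lambda>\<xi>. norm (A *v \<xi>))"
    by (intro continuous_intros)
  moreover have "sphere (0 :: real ^ 'n) 1 \<noteq> {}"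
    by simp
  ultimately obtain \<xi> where \<xi>: "\<xi> \<in> sphere 0 1"
      "\<forall>y\<in>sphere 0 1. norm (A *v y) \<le> norm (A *v \<xi>)"
    using continuous_attains_sup[OF compact_sphere] by blast
  have n1: "norm \<xi> = 1"
    using \<xi>(1) by simp
  have "norm (A *v x) \<le> norm (A *v \<xi>) * norm x" for x
  proof (cases "x = 0")
    case False
    then have "norm (A *v ((1 / norm x) *\<^sub>R x)) \<le> norm (A *v \<xi>)"
      by (intro \<xi>(2)[rule_format]) simp
    then show ?thesis
      using False by (simp add: matrix_vector_mult_scaleR field_simps)
  qed simp
  then have "opnorm A \<le> norm (A *v \<xi>)"
    unfolding opnorm_def by (rule onorm_le)
  with opnorm_le[OF n1, of A] n1 show ?thesis
    by (intro exI[of _ \<xi>]) simp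
qed

definition burkholder :: "real \<Rightarrow> real ^ 3 ^ 3 \<Rightarrow> real" where
  "burkholder p A =
     (if A = 0 then 0
      else (\<bar>1 - 3 / p\<bar> * opnorm A ^ 3 + det A) * opnorm A powr (p - 3))"

definition burkholder_plus :: "real \<Rightarrow> real ^ 3 ^ 3 \<Rightarrow> real" where
  "burkholder_plus p A = max 0 (burkholder p A)"

text \<open>Minor of order 2 with rows \<open>i\<close>, \<open>i'\<close> and columns \<open>j\<close>, \<open>j'\<close>.\<close>

definition minor2 :: "real ^ 3 ^ 3 \<Rightarrow> 3 \<Rightarrow> 3 \<Rightarrow> 3 \<Rightarrow> 3 \<Rightarrow> real" where
  "minor2 A i i' j j' =
     det (vector [vector [A $ i $ j, A $ i $ j'], vector [A $ i' $ j, A $ i' $ j']] :: real ^ 2 ^ 2)"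

definition minors :: "real ^ 3 ^ 3 \<Rightarrow> real ^ 19" where
  "minors A = vector
     [A $ 1 $ 1, A $ 1 $ 2, A $ 1 $ 3,
      A $ 2 $ 1, A $ 2 $ 2, A $ 2 $ 3,
      A $ 3 $ 1, A $ 3 $ 2, A $ 3 $ 3,
      minor2 A 1 2 1 2, minor2 A 1 2 1 3, minor2 A 1 2 2 3,
      minor2 A 1 3 1 2, minor2 A 1 3 1 3, minor2 A 1 3 2 3,
      minor2 A 2 3 1 2, minor2 A 2 3 1 3, minor2 A 2 3 2 3,
      det A]"

definition polyconvex_at :: "(real ^ 3 ^ 3 \<Rightarrow> real) \<Rightarrow> real ^ 3 ^ 3 \<Rightarrow> bool" where
  "polyconvex_at F A \<longleftrightarrow>
     (\<exists>G :: real ^ 19 \<Rightarrow> real. convex_on UNIV G \<and> F A = G (minors A) \<and> (\<forall>X. F X \<ge> G (minors X)))"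

definition polyconvex :: "(real ^ 3 ^ 3 \<Rightarrow> real) \<Rightarrow> bool" where
  "polyconvex F \<longleftrightarrow> (\<forall>A. polyconvex_at F A)"

end

theory Submission
  imports Defs
begin

text \<open>
  A function that is polyconvex at \<open>A\<close> satisfies Jensen's inequality for every finite family of
  matrices whose minors average to the minors of \<open>A\<close>. For \<open>A = diag(1,0,0)\<close> and \<open>c = 1 - 3/p\<close> this
  fails for the six diagonal matrices \<open>(0, \<plusminus>t, \<mp>t)\<close>, \<open>(s\<^sub>1, \<plusminus>\<surd>c, \<mp>\<surd>c)\<close>, \<open>(s\<^sub>2, \<plusminus>\<surd>c, \<plusminus>\<surd>c)\<close>,
  where \<open>t\<close> is slightly larger than 1, the first pair has a small total weight \<open>u\<close>, and \<open>s\<^sub>1, s\<^sub>2\<close>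
  are determined by balancing the minors. To first order in \<open>u\<close>, the right-hand side of Jensen's
  inequality, divided by \<open>c\<close>, is \<open>1 + u (t\<^sup>p + p - 1 - p t\<^sup>2)\<close>, which is less than 1 because
  \<open>t\<^sup>p - 1 < p (t\<^sup>2 - 1)\<close> for \<open>t\<close> close to 1. The family is found by duality: on diagonal matrices
  the integrand near the face \<open>x\<^sub>1 = 1\<close> determines the supporting functional at \<open>A\<close>, and the functional obtained exceeds
  the integrand at \<open>(0, t, -t)\<close>.
\<close>

text \<open>Together with \<open>scaleR_vector\<close> this collapses a weighted sum of explicit
  minor vectors into one list. The start index \<open>n\<close> stays general because every list
  entry advances it.\<close>

lemma vector_add:
  assumes "length xs = length ys"
  shows "(vector xs :: 'a :: ab_group_add ^ 'n :: {finite, one, plus}) + vector ys = vector (map2 (+) xs ys)"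
proof -
  let ?f = "\<lambda>zs :: 'a list. foldr (\<lambda>x f n. (f (n + 1))(n := x)) zs (\<lambda>n x. 0)"
  have "?f (map2 (+) xs ys) n i = ?f xs n i + ?f ys n i" for n i :: 'n
    using assms by (induction xs ys arbitrary: n rule: list_induct2) auto
  then show ?thesis
    by (simp add: vector_def vec_eq_iff)
qed

lemma scaleR_vector:
  "a *\<^sub>R (vector xs :: real ^ 'n :: {finite, one, plus}) = vector (map ((*) a) xs)"
proof -
  let ?f = "\<lambda>zs :: real list. foldr (\<lambda>x f n. (f (n + 1))(n := x)) zs (\<lambda>n x. 0)"
  have "?f (map ((*) a) xs) n i = a * ?f xs n i" for n i :: 'n
    by (induction xs arbitrary: n) auto
  then show ?thesis
    by (simp add: vector_def vec_eq_iff)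
qed

lemma polyconvex_at_jensen:
  assumes "polyconvex_at F A" "finite I" "sum w I = 1" "\<And>i. i \<in> I \<Longrightarrow> w i \<ge> 0"
    and "minors A = (\<Sum>i\<in>I. w i *\<^sub>R minors (X i))"
  shows "F A \<le> (\<Sum>i\<in>I. w i * F (X i))"
proof -
  obtain G where G: "convex_on UNIV G" "F A = G (minors A)" "\<And>X. F X \<ge> G (minors X)"
    using assms(1) unfolding polyconvex_at_def by blast
  have "I \<noteq> {}"
    using assms(3) by auto
  then have "F A \<le> (\<Sum>i\<in>I. w i * G (minors (X i)))"
    using convex_on_sum[OF assms(2) _ G(1) assms(3)] assms(4,5) G(2) by simp
  also have "\<dots> \<le> (\<Sum>i\<in>I. w i * F (X i))"
    using G(3) assms(4) by (intro sum_mono mult_left_mono) auto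
  finally show ?thesis .
qed

definition diag :: "real \<Rightarrow> real \<Rightarrow> real \<Rightarrow> real ^ 3 ^ 3" where
  "diag x y z = vector [vector [x, 0, 0], vector [0, y, 0], vector [0, 0, z]]"

lemma diag_mult: "diag x y z *v v = vector [x * v $ 1, y * v $ 2, z * v $ 3]"
  by (simp add: diag_def vec_eq_iff forall_3 matrix_vector_mult_def sum_3)

lemma det_diag: "det (diag x y z) = x * y * z"
  by (simp add: diag_def det_3)

lemma minors_diag:
  "minors (diag x y z) =
     vector [x, 0, 0, 0, y, 0, 0, 0, z, x * y, 0, 0, 0, x * z, 0, 0, 0, y * z, x * y * z]"
  by (simp add: minors_def minor2_def det_2 det_diag) (simp add: diag_def)

text \<open>The upper bound holds componentwise; the lower bound comes from the coordinate unit
  vectors, which pick out single diagonal entries.\<close>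

lemma opnorm_diag:
  assumes "\<bar>x\<bar> \<le> m" "\<bar>y\<bar> \<le> m" "\<bar>z\<bar> \<le> m" "m \<in> {\<bar>x\<bar>, \<bar>y\<bar>, \<bar>z\<bar>}"
  shows "opnorm (diag x y z) = m"
proof (rule antisym)
  have m: "0 \<le> m"
    using assms(1) by linarith
  have "norm (diag x y z *v v) \<le> m * norm v" for v
  proof -
    have "norm ((diag x y z *v v) $ i) \<le> norm ((m *\<^sub>R v) $ i)" for i
      using assms(1-3) m exhaust_3[of i] by (auto simp: diag_mult abs_mult mult_right_mono)
    then have "norm (diag x y z *v v) \<le> norm (m *\<^sub>R v)"
      by (rule norm_le_componentwise_cart)
    then show ?thesis
      using m by simp
  qed
  then show "opnorm (diag x y z) \<le> m"
    unfolding opnorm_def by (rule onorm_le)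
  have *: "\<bar>(diag x y z *v axis k 1) $ k\<bar> \<le> opnorm (diag x y z)" for k
    using component_le_norm_cart[of "diag x y z *v axis k 1" k] opnorm_le[of "axis k 1" "diag x y z"]
    by (auto simp: norm_axis_1)
  show "m \<le> opnorm (diag x y z)"
    using *[of 1] *[of 2] *[of 3] assms(4) by (auto simp: diag_mult axis_def)
qed

lemma burkholder_plus_diag:
  assumes "p > 3" "m > 0" "\<bar>x\<bar> \<le> m" "\<bar>y\<bar> \<le> m" "\<bar>z\<bar> \<le> m" "m \<in> {\<bar>x\<bar>, \<bar>y\<bar>, \<bar>z\<bar>}"
  shows "burkholder_plus p (diag x y z) =
    max 0 (((1 - 3 / p) * m ^ 3 + x * y * z) * m powr (p - 3))"
proof -
  have "opnorm (diag x y z) = m"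
    using assms by (intro opnorm_diag) auto
  moreover have "opnorm (0 :: real ^ 3 ^ 3) = 0"
    by (simp add: opnorm_def onorm_zero)
  ultimately have "diag x y z \<noteq> 0"
    using assms(2) by auto
  moreover have "\<bar>1 - 3 / p\<bar> = 1 - 3 / p"
    using assms(1) by simp
  ultimately show ?thesis
    using \<open>opnorm (diag x y z) = m\<close>
    by (simp add: burkholder_plus_def burkholder_def det_diag)
qed

text \<open>Both sides equal 1 at \<open>t = 1\<close>, where the left has slope \<open>p\<close>
  and the right has slope \<open>2 * p\<close>.\<close>

lemma ex_powr_less:
  fixes p :: real
  assumes "p > 3"
  shows "\<exists>t>1. t powr p < p * t\<^sup>2 - p + 1"
proof -
  have "((\<lambda>t. p * t\<^sup>2 - p + 1 - t powr p) has_real_derivative p) (at 1)"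
    by (auto intro!: derivative_eq_intros)
  then obtain d where d: "d > 0"
      "\<And>h. 0 < h \<Longrightarrow> h < d \<Longrightarrow> p * 1\<^sup>2 - p + 1 - 1 powr p < p * (1 + h)\<^sup>2 - p + 1 - (1 + h) powr p"
    using DERIV_pos_inc_right[of "\<lambda>t. p * t\<^sup>2 - p + 1 - t powr p" p 1] assms by auto
  from d(1) d(2)[of "d / 2"] show ?thesis
    by (intro exI[of _ "1 + d / 2"]) auto
qed

text \<open>The last expression equals 1 at \<open>u = 0\<close> and has negative slope there; the
  other conditions hold for small \<open>u > 0\<close> by continuity.\<close>

lemma ex_small_weight:
  fixes p k T r :: real
  assumes "r < 1" "T + p - 1 < (p - 3) * k"
  defines "s1 \<equiv> \<lambda>u. 1 / (1 - (1 + k) * u)" and "s2 \<equiv> \<lambda>u. 1 / (1 - (1 - k) * u)"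
  shows "\<exists>u>0. (1 + k) * u < 1 \<and> (1 - k) * u < 1 \<and> r < s2 u \<and>
    u * T + (((s1 u)\<^sup>2 - 1) * s1 u powr (p - 3) + ((s2 u)\<^sup>2 + 1) * s2 u powr (p - 3)) / 2 < 1"
proof -
  define h where "h = (\<lambda>u. u * T +
    (((s1 u)\<^sup>2 - 1) * s1 u powr (p - 3) + ((s2 u)\<^sup>2 + 1) * s2 u powr (p - 3)) / 2)"
  have s0: "s1 0 = 1" "s2 0 = 1"
    by (simp_all add: s1_def s2_def)
  have d: "(s1 has_real_derivative 1 + k) (at 0)" "(s2 has_real_derivative 1 - k) (at 0)"
    unfolding s1_def s2_def by (auto intro!: derivative_eq_intros)
  \<comment> \<open>The \<open>s1\<close> term contributes \<open>1 + k\<close> to the slope, the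
    \<open>s2\<close> term \<open>(p - 2) * (1 - k)\<close>.\<close>
  have "(h has_real_derivative T + p - 1 - (p - 3) * k) (at 0)"
    unfolding h_def
    by (auto intro!: derivative_eq_intros d[THEN DERIV_cong] simp: s0 field_simps)
  then have "\<exists>d>0. \<forall>u>0. u < d \<longrightarrow> h u < h 0"
    using DERIV_neg_dec_right[of h "T + p - 1 - (p - 3) * k" 0] assms(2) by simp
  then have 1: "\<forall>\<^sub>F u in at_right 0. h u < h 0"
    by (auto simp: eventually_at_right_field)
  have 2: "\<forall>\<^sub>F u in at_right 0. (1 + k) * u < 1" "\<forall>\<^sub>F u in at_right 0. (1 - k) * u < 1"
    by (rule order_tendstoD(2)[where y = 0], auto intro!: tendsto_eq_intros)+
  have 3: "\<forall>\<^sub>F u in at_right 0. r < s2 u"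
    unfolding s2_def
    by (rule order_tendstoD(1)[where y = 1]) (use assms(1) in \<open>auto intro!: tendsto_eq_intros\<close>)
  have "\<forall>\<^sub>F u in at_right 0. (0 :: real) < u"
    by (rule eventually_at_right_less)
  then have "\<forall>\<^sub>F u in at_right 0. 0 < u \<and> (1 + k) * u < 1 \<and> (1 - k) * u < 1 \<and> r < s2 u \<and> h u < h 0"
    using 1 2 3 by eventually_elim auto
  moreover have "h 0 = 1"
    by (simp add: h_def s0)
  ultimately have "\<exists>u. 0 < u \<and> (1 + k) * u < 1 \<and> (1 - k) * u < 1 \<and> r < s2 u \<and> h u < 1"
    using eventually_happens'[OF trivial_limit_at_right_real] by simp
  then show ?thesis
    unfolding h_def by blast
qed

theorem proposition1p5:
  fixes p :: real
  assumes "p > 3"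
  shows "\<not> polyconvex (burkholder_plus p)"
proof
  assume "polyconvex (burkholder_plus p)"
  then have pc: "polyconvex_at (burkholder_plus p) (diag 1 0 0)"
    by (simp add: polyconvex_def)
  define c r where "c = 1 - 3 / p" and "r = sqrt c"
  have c: "0 < c" "c < 1" "p * c = p - 3"
    using assms by (auto simp: c_def field_simps)
  then have r: "0 < r" "r < 1" "r * r = c"
    by (auto simp: r_def)
  obtain t where t: "t > 1" "t powr p < p * t\<^sup>2 - p + 1"
    using ex_powr_less[OF assms] by blast
  \<comment> \<open>This value makes the minors in rows and columns 2, 3 average to 0.\<close>
  define k where "k = t\<^sup>2 / c"
  have "(p - 3) * k = p * t\<^sup>2"
    using c(1) by (simp add: k_def c(3)[symmetric])
  with t(2) have "t powr p + p - 1 < (p - 3) * k"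
    by simp
  from ex_small_weight[OF r(2) this] obtain u s1 s2 where
    u: "u > 0" "(1 + k) * u < 1" "(1 - k) * u < 1" and
    s: "s1 = 1 / (1 - (1 + k) * u)" "s2 = 1 / (1 - (1 - k) * u)" "r < s2" and
    less: "u * t powr p + ((s1\<^sup>2 - 1) * s1 powr (p - 3) + (s2\<^sup>2 + 1) * s2 powr (p - 3)) / 2 < 1"
    by blast
  have "k > 0"
    using c t by (simp add: k_def)
  then have s1: "s1 > 1"
    using u by (simp add: s)
  have s2: "s2 > 0"
    using u by (simp add: s)
  have inv: "1 / s1 = 1 - (1 + k) * u" "1 / s2 = 1 - (1 - k) * u"
    by (simp_all add: s)
  define X where "X = (!) [diag 0 t (-t), diag 0 (-t) t, diag s1 r (-r), diag s1 (-r) r,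
    diag s2 r r, diag s2 (-r) (-r)]"
  \<comment> \<open>The pairs with \<open>s1\<close> and \<open>s2\<close> get total weights
    \<open>1 / (2 * s1)\<close> and \<open>1 / (2 * s2)\<close>, so the first entries average to 1
    and the determinants cancel.\<close>
  define w where "w = (!) [u / 2, u / 2, 1 / s1 / 4, 1 / s1 / 4, 1 / s2 / 4, 1 / s2 / 4]"
  have sum6: "sum f {..<6} = f 0 + f 1 + f 2 + f 3 + f 4 + f 5"
    for f :: "nat \<Rightarrow> 'b :: comm_monoid_add"
    by (simp add: eval_nat_numeral ac_simps)
  have "sum w {..<6} = 1"
    unfolding sum6 w_def by (simp add: inv) (simp add: field_simps)
  moreover have "w i \<ge> 0" if "i \<in> {..<6}" for i
    using that u s1 s2 by (auto simp: w_def eval_nat_numeral less_Suc_eq)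
  moreover have "minors (diag 1 0 0) = (\<Sum>i<6. w i *\<^sub>R minors (X i))"
  proof -
    have "u * t\<^sup>2 = c * k * u"
      using c by (simp add: k_def)
    then have "u * t\<^sup>2 = c * (1 / s2 - 1 / s1) / 2"
      by (simp add: inv algebra_simps)
    then show ?thesis
      using s1 s2 r(3)
      unfolding sum6 w_def X_def
      by (simp add: minors_diag scaleR_vector vector_add power2_eq_square) (simp add: field_simps)
  qed
  ultimately have "burkholder_plus p (diag 1 0 0) \<le> (\<Sum>i<6. w i * burkholder_plus p (X i))"
    using polyconvex_at_jensen[OF pc] by blast
  moreover have "burkholder_plus p (diag 1 0 0) = c"
    using burkholder_plus_diag[of p 1 1 0 0] assms c by (simp add: c_def)
  moreover have "burkholder_plus p (diag 0 t (-t)) = c * t powr p"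
      "burkholder_plus p (diag 0 (-t) t) = c * t powr p"
    using burkholder_plus_diag[of p t 0 t "- t"] burkholder_plus_diag[of p t 0 "- t" t] assms c t(1)
      powr_add[of t "p - 3" 3] by (simp_all add: c_def mult_ac)
  \<comment> \<open>Since \<open>r < 1 < s1\<close>, the norm is \<open>s1\<close> and the value is
    already positive.\<close>
  moreover have "burkholder_plus p (diag s1 r (-r)) = c * s1 * ((s1\<^sup>2 - 1) * s1 powr (p - 3))"
      "burkholder_plus p (diag s1 (-r) r) = c * s1 * ((s1\<^sup>2 - 1) * s1 powr (p - 3))"
    using burkholder_plus_diag[of p s1 s1 r "- r"] burkholder_plus_diag[of p s1 s1 "- r" r]
      assms r(1,2) s1 c(1) one_less_power[OF s1, of 2]
    by (simp_all add: c_def[symmetric] r(3)[symmetric] power2_eq_square power3_eq_cube algebra_simps)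
  \<comment> \<open>Here \<open>k > 1\<close> gives \<open>s2 < 1\<close>, so it is
    \<open>r < s2\<close> that makes \<open>s2\<close> the norm.\<close>
  moreover have "burkholder_plus p (diag s2 r r) = c * s2 * ((s2\<^sup>2 + 1) * s2 powr (p - 3))"
      "burkholder_plus p (diag s2 (-r) (-r)) = c * s2 * ((s2\<^sup>2 + 1) * s2 powr (p - 3))"
    using burkholder_plus_diag[of p s2 s2 r r] burkholder_plus_diag[of p s2 s2 "- r" "- r"]
      assms r(1,2) s2 c(1) s(3)
    by (simp_all add: c_def[symmetric] r(3)[symmetric] power2_eq_square power3_eq_cube algebra_simps)
  \<comment> \<open>The factors \<open>s1\<close> and \<open>s2\<close> split off in the values
    cancel against the weights.\<close>
  ultimately have "c \<le> c * (u * t powr p +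
      ((s1\<^sup>2 - 1) * s1 powr (p - 3) + (s2\<^sup>2 + 1) * s2 powr (p - 3)) / 2)"
    using s1 s2 unfolding sum6 w_def X_def
    by (simp add: algebra_simps add_divide_distrib diff_divide_distrib)
  with less c(1) show False
    by (simp add: mult_le_cancel_left1)
qed

end
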